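(* The recurrence relations $\alpha$-$q$-P$_{\rm I}$ (given in the context) can be seen as a limiting case of the set of asymmetric discrete Painlevé equations $\alpha$-$q$-P$_{\rm V}$ (given in the context). Namely, consider $\alpha$-$q$-P$_{\rm V}$ with the particular choice of parameters $$p=1,\quad r=c,\quad s=\kappa,\quad t=\frac{1}{c\kappa},\quad b=c\kappa,\quad \rho_n=q^{2n},\quad a=\kappa,\quad w_n=q^{2n+\alpha+1}.$$ Then, letting $\kappa$ tend to $0$, one obtains as a limit the set of equations $$\begin{cases} q^{2n}(1-u_nv_n)(1-u_nv_{n-1})=(1-u_n)(1-cu_n),\\ q^{2n+1+\alpha}(1-u_nv_n)(1-u_{n+1}v_n)=(1-v_n)(1-v_n/c),\end{cases}$$ that is, $\alpha$-$q$-P$_{\rm I}$.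
   Context: Here $0<q<1$, $\alpha>-1$ and $c<0$. The set of equations $\alpha$-$q$-P$_{\rm V}$, for sequences $u_n,v_n$, with parameters $p,r,s,t,a,b$ satisfying $prst=1$ and with sequences $\rho_n,w_n$, is $$(1-u_nv_n)(1-u_nv_{n-1})=\frac{(u_n-1/p)(u_n-1/r)(u_n-1/s)(u_n-1/t)}{(u_n-b\rho_n)(u_n-\rho_n/b)},$$ $$(1-u_nv_n)(1-u_{n+1}v_n)=\frac{(v_n-p)(v_n-r)(v_n-s)(v_n-t)}{(v_n-aw_n)(v_n-w_n/a)}.$$ The set of equations $\alpha$-$q$-P$_{\rm I}$, for sequences $u_n,v_n$, is $$q^{2n}(1-u_nv_n)(1-u_nv_{n-1})=(1-u_n)(1-cu_n),$$ $$q^{2n+1+\alpha}(1-u_nv_n)(1-u_{n+1}v_n)=(1-v_n)(1-v_n/c).$$ It arises from the recurrence $$q^{n-\alpha}(-cy_ny_{n+1}+q^\alpha)(-cy_ny_{n-1}+q^\alpha)=\begin{cases}(q^\alpha-y_n)(q^\alpha-cy_n)q^{-\alpha}, & n\text{ even},\\ (1-y_n)(1-cy_n), & n\text{ odd},\end{cases}$$ by setting $u_n=y_{2n}q^{-\alpha}$ and $v_n=cy_{2n+1}$.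
   Formalization: The limit is taken where the limiting values satisfy u_n ≠ 0 (first equation) and v_n ≠ 0 (second equation); for fixed u_n = 0 and n ≠ 0 the first right-hand side times q^{2n} is q^{-2n} for every κ, not 1. *)

theory Defs
  imports Complex_Main
begin

text \<open>
  Sequences are indexed by integers, so that \<open>v (n - 1)\<close> needs no convention at the left end.
  The systems carry two index sets: the first equation is imposed for \<open>n \<in> I\<close>, the second one
  for \<open>n \<in> J\<close> (e.g. \<open>I = {1..}\<close>, \<open>J = {0..}\<close> for one-sided sequences starting at \<open>0\<close>).
\<close>

definition lhs_u :: "(int \<Rightarrow> 'a::field) \<Rightarrow> (int \<Rightarrow> 'a) \<Rightarrow> int \<Rightarrow> 'a" where
  "lhs_u u v n = (1 - u n * v n) * (1 - u n * v (n - 1))"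

definition lhs_v :: "(int \<Rightarrow> 'a::field) \<Rightarrow> (int \<Rightarrow> 'a) \<Rightarrow> int \<Rightarrow> 'a" where
  "lhs_v u v n = (1 - u n * v n) * (1 - u (n + 1) * v n)"

definition PV_num_u :: "'a::field \<Rightarrow> 'a \<Rightarrow> 'a \<Rightarrow> 'a \<Rightarrow> (int \<Rightarrow> 'a) \<Rightarrow> int \<Rightarrow> 'a" where
  "PV_num_u p r s t u n = (u n - 1 / p) * (u n - 1 / r) * (u n - 1 / s) * (u n - 1 / t)"

definition PV_den_u :: "'a::field \<Rightarrow> (int \<Rightarrow> 'a) \<Rightarrow> (int \<Rightarrow> 'a) \<Rightarrow> int \<Rightarrow> 'a" where
  "PV_den_u b \<rho> u n = (u n - b * \<rho> n) * (u n - \<rho> n / b)"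

definition PV_num_v :: "'a::field \<Rightarrow> 'a \<Rightarrow> 'a \<Rightarrow> 'a \<Rightarrow> (int \<Rightarrow> 'a) \<Rightarrow> int \<Rightarrow> 'a" where
  "PV_num_v p r s t v n = (v n - p) * (v n - r) * (v n - s) * (v n - t)"

definition PV_den_v :: "'a::field \<Rightarrow> (int \<Rightarrow> 'a) \<Rightarrow> (int \<Rightarrow> 'a) \<Rightarrow> int \<Rightarrow> 'a" where
  "PV_den_v a w v n = (v n - a * w n) * (v n - w n / a)"

text \<open>
  The fractions are required to be meaningful: their denominators must not vanish.
\<close>

definition alpha_q_PV ::
  "int set \<Rightarrow> int set \<Rightarrow> 'a::field \<Rightarrow> 'a \<Rightarrow> 'a \<Rightarrow> 'a \<Rightarrow> 'a \<Rightarrow> 'a \<Rightarrow> (int \<Rightarrow> 'a) \<Rightarrow> (int \<Rightarrow> 'a)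
    \<Rightarrow> (int \<Rightarrow> 'a) \<Rightarrow> (int \<Rightarrow> 'a) \<Rightarrow> bool" where
  "alpha_q_PV I J p r s t a b \<rho> w u v \<longleftrightarrow>
     p * r * s * t = 1 \<and>
     (\<forall>n\<in>I. PV_den_u b \<rho> u n \<noteq> 0 \<and>
        lhs_u u v n = PV_num_u p r s t u n / PV_den_u b \<rho> u n) \<and>
     (\<forall>n\<in>J. PV_den_v a w v n \<noteq> 0 \<and>
        lhs_v u v n = PV_num_v p r s t v n / PV_den_v a w v n)"

text \<open>
  The parameters \<open>q\<close>, \<open>\<alpha>\<close>, \<open>c\<close> are real, while the unknowns live in an arbitrary real normed
  field, so that real and complex sequences are both covered.
\<close>

definition PI_rhs_u :: "real \<Rightarrow> (int \<Rightarrow> 'a::real_normed_field) \<Rightarrow> int \<Rightarrow> 'a" where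
  "PI_rhs_u c u n = (1 - u n) * (1 - of_real c * u n)"

definition PI_rhs_v :: "real \<Rightarrow> (int \<Rightarrow> 'a::real_normed_field) \<Rightarrow> int \<Rightarrow> 'a" where
  "PI_rhs_v c v n = (1 - v n) * (1 - v n / of_real c)"

definition alpha_q_PI ::
  "int set \<Rightarrow> int set \<Rightarrow> real \<Rightarrow> real \<Rightarrow> real
    \<Rightarrow> (int \<Rightarrow> 'a::real_normed_field) \<Rightarrow> (int \<Rightarrow> 'a) \<Rightarrow> bool" where
  "alpha_q_PI I J q \<alpha> c u v \<longleftrightarrow>
     (\<forall>n\<in>I. of_real (q powr (2 * of_int n)) * lhs_u u v n = PI_rhs_u c u n) \<and>
     (\<forall>n\<in>J. of_real (q powr (2 * of_int n + 1 + \<alpha>)) * lhs_v u v n = PI_rhs_v c v n)"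

end

theory Submission imports Defs begin

text \<open>
  Why the degeneration holds. On each right-hand side of the \<open>q\<close>-P\<open>\<^sub>V\<close> system the numerator and the
  denominator both contain one root proportional to \<open>\<kappa>\<close> and one proportional to \<open>1 / \<kappa>\<close>. As
  \<open>\<kappa> \<rightarrow> 0\<close> the two small roots merge at the origin, so the factors containing them both tend to the
  limit of the unknown and cancel, as long as this limit is nonzero. The two large roots escape to
  infinity, and the quotient of their factors tends to the quotient of the leading coefficients of
  the roots (\<open>ratio_confluence\<close>). Only the two fixed roots survive: \<open>1\<close> and \<open>1 / c\<close> for \<open>u\<close>,
  \<open>1\<close> and \<open>c\<close> for \<open>v\<close>. The constant left by the large roots is \<open>c / \<rho>\<^sub>n\<close>, respectively
  \<open>1 / (c w\<^sub>n)\<close>; its \<open>n\<close>-dependent part is what the prefactors \<open>q\<^bsup>2n\<^esup>\<close> and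
  \<open>q\<^bsup>2n+1+\<alpha>\<^esup>\<close> of the \<open>q\<close>-P\<open>\<^sub>I\<close> system compensate, and its factor \<open>c\<^bsup>\<plusminus>1\<^esup>\<close> normalises the
  quadratic polynomial. The left-hand sides are polynomial in the unknowns, hence continuous, and
  uniqueness of limits turns the convergence of both sides into the limit equations.
\<close>

text \<open>
  The poles do not persist: one denominator factor tends to \<open>X\<close>, and the other, once multiplied
  by \<open>\<kappa>\<close>, tends to \<open>- g\<close>.
\<close>

lemma eventually_confluent_den_nonzero:
  fixes x :: "'a::real_normed_field \<Rightarrow> 'a"
  assumes x: "(x \<longlongrightarrow> X) (at 0)" and X: "X \<noteq> 0" and g: "g \<noteq> 0"
  shows "\<forall>\<^sub>F \<kappa> in at 0. (x \<kappa> - f * \<kappa>) * (x \<kappa> - g / \<kappa>) \<noteq> 0"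
proof -
  have "((\<lambda>\<kappa>. (x \<kappa> - f * \<kappa>) * (\<kappa> * x \<kappa> - g)) \<longlongrightarrow> (X - f * 0) * (0 * X - g)) (at 0)"
    by (intro tendsto_intros x)
  then have "\<forall>\<^sub>F \<kappa> in at 0. (x \<kappa> - f * \<kappa>) * (\<kappa> * x \<kappa> - g) \<noteq> 0"
    by (rule tendsto_imp_eventually_ne) (use X g in simp)
  moreover have "\<forall>\<^sub>F \<kappa> in at (0::'a). \<kappa> \<noteq> 0"
    by (rule eventually_neq_at_within)
  ultimately show ?thesis
    by eventually_elim (auto simp: field_simps)
qed

text \<open>
  The confluence itself. Multiplying the quotient of the large-root factors through by \<open>\<kappa>\<close> gives
  \<open>(\<kappa> x - d) / (\<kappa> x - g)\<close>, which has the regular limit \<open>d / g\<close>; this is why \<open>x\<close> itself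
  needs no rescaling.
\<close>

lemma ratio_confluence:
  fixes x :: "'a::real_normed_field \<Rightarrow> 'a"
  assumes x: "(x \<longlongrightarrow> X) (at 0)" and X: "X \<noteq> 0" and g: "g \<noteq> 0"
  shows "((\<lambda>\<kappa>. ((x \<kappa> - A) * (x \<kappa> - B) * ((x \<kappa> - e * \<kappa>) * (x \<kappa> - d / \<kappa>)))
             / ((x \<kappa> - f * \<kappa>) * (x \<kappa> - g / \<kappa>)))
           \<longlongrightarrow> (X - A) * (X - B) * (d / g)) (at 0)"
proof -
  have "((\<lambda>\<kappa>. (x \<kappa> - A) * (x \<kappa> - B) *
            ((x \<kappa> - e * \<kappa>) / (x \<kappa> - f * \<kappa>) * ((\<kappa> * x \<kappa> - d) / (\<kappa> * x \<kappa> - g))))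
          \<longlongrightarrow> (X - A) * (X - B) *
            ((X - e * 0) / (X - f * 0) * ((0 * X - d) / (0 * X - g)))) (at 0)"
    by (intro tendsto_intros x) (use X g in simp_all)
  moreover have "(X - A) * (X - B) * ((X - e * 0) / (X - f * 0) * ((0 * X - d) / (0 * X - g)))
      = (X - A) * (X - B) * (d / g)"
    using X by simp
  moreover have "\<forall>\<^sub>F \<kappa> in at 0.
      (x \<kappa> - A) * (x \<kappa> - B) *
        ((x \<kappa> - e * \<kappa>) / (x \<kappa> - f * \<kappa>) * ((\<kappa> * x \<kappa> - d) / (\<kappa> * x \<kappa> - g)))
      = ((x \<kappa> - A) * (x \<kappa> - B) * ((x \<kappa> - e * \<kappa>) * (x \<kappa> - d / \<kappa>)))
         / ((x \<kappa> - f * \<kappa>) * (x \<kappa> - g / \<kappa>))"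
    using eventually_neq_at_within[of 0 0 UNIV]
  proof eventually_elim
    case (elim \<kappa>)
    have "\<kappa> * x \<kappa> - d = \<kappa> * (x \<kappa> - d / \<kappa>)" "\<kappa> * x \<kappa> - g = \<kappa> * (x \<kappa> - g / \<kappa>)"
      using elim by (simp_all add: field_simps)
    then have "(\<kappa> * x \<kappa> - d) / (\<kappa> * x \<kappa> - g) = (x \<kappa> - d / \<kappa>) / (x \<kappa> - g / \<kappa>)"
      using elim by simp
    then show ?case by simp
  qed
  ultimately show ?thesis
    by (simp only: tendsto_cong)
qed

text \<open>
  For \<open>u\<close> the large root \<open>1 / s = 1 / \<kappa>\<close> of the numerator meets the root
  \<open>\<rho> / b = (\<rho> / c) / \<kappa>\<close> of the denominator, which leaves the constant \<open>c / \<rho>\<close>.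
\<close>

lemma PV_u_confluence:
  fixes u :: "'a::real_normed_field \<Rightarrow> int \<Rightarrow> 'a" and c :: real
  assumes u: "((\<lambda>\<kappa>. u \<kappa> n) \<longlongrightarrow> U n) (at 0)" and U: "U n \<noteq> 0"
    and c: "c \<noteq> 0" and \<rho>: "\<rho> n \<noteq> 0"
  shows "\<forall>\<^sub>F \<kappa> in at 0. PV_den_u (of_real c * \<kappa>) \<rho> (u \<kappa>) n \<noteq> 0"
    and "((\<lambda>\<kappa>. \<rho> n * (PV_num_u 1 (of_real c) \<kappa> (1 / (of_real c * \<kappa>)) (u \<kappa>) n
                 / PV_den_u (of_real c * \<kappa>) \<rho> (u \<kappa>) n)) \<longlongrightarrow> PI_rhs_u c U n) (at 0)"
proof -
  have g: "\<rho> n / of_real c \<noteq> 0" using c \<rho> by simp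
  show "\<forall>\<^sub>F \<kappa> in at 0. PV_den_u (of_real c * \<kappa>) \<rho> (u \<kappa>) n \<noteq> 0"
    using eventually_confluent_den_nonzero[OF u U g, of "of_real c * \<rho> n"]
    by (simp add: PV_den_u_def mult_ac)
  have "((\<lambda>\<kappa>. \<rho> n * (PV_num_u 1 (of_real c) \<kappa> (1 / (of_real c * \<kappa>)) (u \<kappa>) n
                 / PV_den_u (of_real c * \<kappa>) \<rho> (u \<kappa>) n))
      \<longlongrightarrow> \<rho> n * ((U n - 1) * (U n - 1 / of_real c) * (1 / (\<rho> n / of_real c)))) (at 0)"
    using tendsto_mult_left[OF ratio_confluence[OF u U g, of 1 "1 / of_real c" "of_real c" 1
          "of_real c * \<rho> n"], of "\<rho> n"]
    by (simp add: PV_num_u_def PV_den_u_def mult_ac)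
  moreover have "\<rho> n * ((U n - 1) * (U n - 1 / of_real c) * (1 / (\<rho> n / of_real c)))
      = PI_rhs_u c U n"
    using c \<rho> by (simp add: PI_rhs_u_def field_simps)
  ultimately show "((\<lambda>\<kappa>. \<rho> n * (PV_num_u 1 (of_real c) \<kappa> (1 / (of_real c * \<kappa>)) (u \<kappa>) n
                 / PV_den_u (of_real c * \<kappa>) \<rho> (u \<kappa>) n)) \<longlongrightarrow> PI_rhs_u c U n) (at 0)"
    by simp
qed

text \<open>
  For \<open>v\<close> the large root \<open>t = (1 / c) / \<kappa>\<close> of the numerator meets \<open>w / a = w / \<kappa>\<close>, which
  leaves the constant \<open>1 / (c w)\<close>.
\<close>

lemma PV_v_confluence:
  fixes v :: "'a::real_normed_field \<Rightarrow> int \<Rightarrow> 'a" and c :: real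
  assumes v: "((\<lambda>\<kappa>. v \<kappa> n) \<longlongrightarrow> V n) (at 0)" and V: "V n \<noteq> 0"
    and c: "c \<noteq> 0" and w: "w n \<noteq> 0"
  shows "\<forall>\<^sub>F \<kappa> in at 0. PV_den_v \<kappa> w (v \<kappa>) n \<noteq> 0"
    and "((\<lambda>\<kappa>. w n * (PV_num_v 1 (of_real c) \<kappa> (1 / (of_real c * \<kappa>)) (v \<kappa>) n
                 / PV_den_v \<kappa> w (v \<kappa>) n)) \<longlongrightarrow> PI_rhs_v c V n) (at 0)"
proof -
  show "\<forall>\<^sub>F \<kappa> in at 0. PV_den_v \<kappa> w (v \<kappa>) n \<noteq> 0"
    using eventually_confluent_den_nonzero[OF v V w, of "w n"]
    by (simp add: PV_den_v_def mult_ac)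
  have "((\<lambda>\<kappa>. w n * (PV_num_v 1 (of_real c) \<kappa> (1 / (of_real c * \<kappa>)) (v \<kappa>) n
                 / PV_den_v \<kappa> w (v \<kappa>) n))
      \<longlongrightarrow> w n * ((V n - 1) * (V n - of_real c) * (1 / of_real c / w n))) (at 0)"
    using tendsto_mult_left[OF ratio_confluence[OF v V w, of 1 "of_real c" 1 "1 / of_real c"
          "w n"], of "w n"]
    by (simp add: PV_num_v_def PV_den_v_def mult_ac)
  moreover have "w n * ((V n - 1) * (V n - of_real c) * (1 / of_real c / w n))
      = PI_rhs_v c V n"
    using c w by (simp add: PI_rhs_v_def field_simps)
  ultimately show "((\<lambda>\<kappa>. w n * (PV_num_v 1 (of_real c) \<kappa> (1 / (of_real c * \<kappa>)) (v \<kappa>) n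
                 / PV_den_v \<kappa> w (v \<kappa>) n)) \<longlongrightarrow> PI_rhs_v c V n) (at 0)"
    by simp
qed

theorem mainTheorem3:
  fixes q \<alpha> c :: real
    and p r s t a b :: "'a::real_normed_field \<Rightarrow> 'a"
    and \<rho> w :: "int \<Rightarrow> 'a"
  assumes q: "0 < q" "q < 1" and \<alpha>: "\<alpha> > -1" and c: "c < 0"
    and p: "\<And>\<kappa>. p \<kappa> = 1"
    and r: "\<And>\<kappa>. r \<kappa> = of_real c"
    and s: "\<And>\<kappa>. s \<kappa> = \<kappa>"
    and t: "\<And>\<kappa>. t \<kappa> = 1 / (of_real c * \<kappa>)"
    and b: "\<And>\<kappa>. b \<kappa> = of_real c * \<kappa>"
    and \<rho>: "\<And>n. \<rho> n = of_real (q powr (2 * of_int n))"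
    and a: "\<And>\<kappa>. a \<kappa> = \<kappa>"
    and w: "\<And>n. w n = of_real (q powr (2 * of_int n + \<alpha> + 1))"
  shows
    \<comment> \<open>the choice of parameters is admissible\<close>
    "(\<forall>\<kappa>. \<kappa> \<noteq> 0 \<longrightarrow> p \<kappa> * r \<kappa> * s \<kappa> * t \<kappa> = 1) \<and>
    \<comment> \<open>both sides of each equation, multiplied by a nonzero factor independent of
        \<open>\<kappa>\<close>, converge to the corresponding sides of the limit equation\<close>
     (\<forall>(u :: 'a \<Rightarrow> int \<Rightarrow> 'a) v U V.
        (\<forall>n. ((\<lambda>\<kappa>. u \<kappa> n) \<longlongrightarrow> U n) (at 0)) \<and> (\<forall>n. ((\<lambda>\<kappa>. v \<kappa> n) \<longlongrightarrow> V n) (at 0)) \<longrightarrow>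
        (\<forall>n. U n \<noteq> 0 \<longrightarrow>
           (\<forall>\<^sub>F \<kappa> in at 0. PV_den_u (b \<kappa>) \<rho> (u \<kappa>) n \<noteq> 0) \<and>
           ((\<lambda>\<kappa>. of_real (q powr (2 * of_int n)) * lhs_u (u \<kappa>) (v \<kappa>) n)
              \<longlongrightarrow> of_real (q powr (2 * of_int n)) * lhs_u U V n) (at 0) \<and>
           ((\<lambda>\<kappa>. of_real (q powr (2 * of_int n)) *
                (PV_num_u (p \<kappa>) (r \<kappa>) (s \<kappa>) (t \<kappa>) (u \<kappa>) n / PV_den_u (b \<kappa>) \<rho> (u \<kappa>) n))
              \<longlongrightarrow> PI_rhs_u c U n) (at 0)) \<and>
        (\<forall>n. V n \<noteq> 0 \<longrightarrow>
           (\<forall>\<^sub>F \<kappa> in at 0. PV_den_v (a \<kappa>) w (v \<kappa>) n \<noteq> 0) \<and>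
           ((\<lambda>\<kappa>. of_real (q powr (2 * of_int n + 1 + \<alpha>)) * lhs_v (u \<kappa>) (v \<kappa>) n)
              \<longlongrightarrow> of_real (q powr (2 * of_int n + 1 + \<alpha>)) * lhs_v U V n) (at 0) \<and>
           ((\<lambda>\<kappa>. of_real (q powr (2 * of_int n + 1 + \<alpha>)) *
                (PV_num_v (p \<kappa>) (r \<kappa>) (s \<kappa>) (t \<kappa>) (v \<kappa>) n / PV_den_v (a \<kappa>) w (v \<kappa>) n))
              \<longlongrightarrow> PI_rhs_v c V n) (at 0))) \<and>
    \<comment> \<open>limits of solutions solve the limit system\<close>
     (\<forall>I J (u :: 'a \<Rightarrow> int \<Rightarrow> 'a) v U V.
        (\<forall>n. ((\<lambda>\<kappa>. u \<kappa> n) \<longlongrightarrow> U n) (at 0)) \<and> (\<forall>n. ((\<lambda>\<kappa>. v \<kappa> n) \<longlongrightarrow> V n) (at 0)) \<and>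
        (\<forall>n\<in>I. U n \<noteq> 0) \<and> (\<forall>n\<in>J. V n \<noteq> 0) \<and>
        (\<forall>\<^sub>F \<kappa> in at 0. alpha_q_PV I J (p \<kappa>) (r \<kappa>) (s \<kappa>) (t \<kappa>) (a \<kappa>) (b \<kappa>) \<rho> w (u \<kappa>) (v \<kappa>))
        \<longrightarrow> alpha_q_PI I J q \<alpha> c U V)"
proof -
  have c0: "c \<noteq> 0" using c by simp
  have w': "w n = of_real (q powr (2 * of_int n + 1 + \<alpha>))" for n
    by (simp add: w add_ac)
  have \<rho>0: "\<rho> n \<noteq> 0" and w0: "w n \<noteq> 0" for n
    using q by (simp_all add: \<rho> w)
  have admissible: "\<kappa> \<noteq> 0 \<Longrightarrow> p \<kappa> * r \<kappa> * s \<kappa> * t \<kappa> = 1" for \<kappa>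
    using c0 by (simp add: p r s t)
  have lim_u:
    "(\<forall>\<^sub>F \<kappa> in at 0. PV_den_u (b \<kappa>) \<rho> (u \<kappa>) n \<noteq> 0) \<and>
     ((\<lambda>\<kappa>. of_real (q powr (2 * of_int n)) * lhs_u (u \<kappa>) (v \<kappa>) n)
        \<longlongrightarrow> of_real (q powr (2 * of_int n)) * lhs_u U V n) (at 0) \<and>
     ((\<lambda>\<kappa>. of_real (q powr (2 * of_int n)) *
          (PV_num_u (p \<kappa>) (r \<kappa>) (s \<kappa>) (t \<kappa>) (u \<kappa>) n / PV_den_u (b \<kappa>) \<rho> (u \<kappa>) n))
        \<longlongrightarrow> PI_rhs_u c U n) (at 0)"
    if u: "\<forall>n. ((\<lambda>\<kappa>. u \<kappa> n) \<longlongrightarrow> U n) (at 0)" and v: "\<forall>n. ((\<lambda>\<kappa>. v \<kappa> n) \<longlongrightarrow> V n) (at 0)"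
      and "U n \<noteq> 0" for u v :: "'a \<Rightarrow> int \<Rightarrow> 'a" and U V n
  proof (intro conjI)
    show "((\<lambda>\<kappa>. of_real (q powr (2 * of_int n)) * lhs_u (u \<kappa>) (v \<kappa>) n)
        \<longlongrightarrow> of_real (q powr (2 * of_int n)) * lhs_u U V n) (at 0)"
      unfolding lhs_u_def by (intro tendsto_intros u[rule_format] v[rule_format])
  qed (use PV_u_confluence[where u = u and n = n and U = U, OF u[rule_format] that(3) c0 \<rho>0]
      in
        \<open>simp_all only: p r s t b flip: \<rho>\<close>)
  have lim_v:
    "(\<forall>\<^sub>F \<kappa> in at 0. PV_den_v (a \<kappa>) w (v \<kappa>) n \<noteq> 0) \<and>
     ((\<lambda>\<kappa>. of_real (q powr (2 * of_int n + 1 + \<alpha>)) * lhs_v (u \<kappa>) (v \<kappa>) n)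
        \<longlongrightarrow> of_real (q powr (2 * of_int n + 1 + \<alpha>)) * lhs_v U V n) (at 0) \<and>
     ((\<lambda>\<kappa>. of_real (q powr (2 * of_int n + 1 + \<alpha>)) *
          (PV_num_v (p \<kappa>) (r \<kappa>) (s \<kappa>) (t \<kappa>) (v \<kappa>) n / PV_den_v (a \<kappa>) w (v \<kappa>) n))
        \<longlongrightarrow> PI_rhs_v c V n) (at 0)"
    if u: "\<forall>n. ((\<lambda>\<kappa>. u \<kappa> n) \<longlongrightarrow> U n) (at 0)" and v: "\<forall>n. ((\<lambda>\<kappa>. v \<kappa> n) \<longlongrightarrow> V n) (at 0)"
      and "V n \<noteq> 0" for u v :: "'a \<Rightarrow> int \<Rightarrow> 'a" and U V n
  proof (intro conjI)
    show "((\<lambda>\<kappa>. of_real (q powr (2 * of_int n + 1 + \<alpha>)) * lhs_v (u \<kappa>) (v \<kappa>) n)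
        \<longlongrightarrow> of_real (q powr (2 * of_int n + 1 + \<alpha>)) * lhs_v U V n) (at 0)"
      unfolding lhs_v_def by (intro tendsto_intros u[rule_format] v[rule_format])
  qed (use PV_v_confluence[where v = v and n = n and V = V, OF v[rule_format] that(3) c0 w0]
      in
        \<open>simp_all only: p r s t a flip: w'\<close>)
  have limit_solves: "alpha_q_PI I J q \<alpha> c U V"
    if u: "\<forall>n. ((\<lambda>\<kappa>. u \<kappa> n) \<longlongrightarrow> U n) (at 0)" and v: "\<forall>n. ((\<lambda>\<kappa>. v \<kappa> n) \<longlongrightarrow> V n) (at 0)"
      and U: "\<forall>n\<in>I. U n \<noteq> 0" and V: "\<forall>n\<in>J. V n \<noteq> 0"
      and sol: "\<forall>\<^sub>F \<kappa> in at 0.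
        alpha_q_PV I J (p \<kappa>) (r \<kappa>) (s \<kappa>) (t \<kappa>) (a \<kappa>) (b \<kappa>) \<rho> w (u \<kappa>) (v \<kappa>)"
    for I J and u v :: "'a \<Rightarrow> int \<Rightarrow> 'a" and U V
    unfolding alpha_q_PI_def
  proof (intro conjI ballI)
    fix n assume n: "n \<in> I"
    then have "\<forall>\<^sub>F \<kappa> in at 0. of_real (q powr (2 * of_int n)) *
          (PV_num_u (p \<kappa>) (r \<kappa>) (s \<kappa>) (t \<kappa>) (u \<kappa>) n / PV_den_u (b \<kappa>) \<rho> (u \<kappa>) n)
        = of_real (q powr (2 * of_int n)) * lhs_u (u \<kappa>) (v \<kappa>) n"
      using sol by (auto elim!: eventually_mono simp: alpha_q_PV_def)
    then show "of_real (q powr (2 * of_int n)) * lhs_u U V n = PI_rhs_u c U n"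
      using lim_u[OF u v, of n] U n
      by (auto intro: tendsto_unique[OF at_neq_bot] Lim_transform_eventually)
  next
    fix n assume n: "n \<in> J"
    then have "\<forall>\<^sub>F \<kappa> in at 0. of_real (q powr (2 * of_int n + 1 + \<alpha>)) *
          (PV_num_v (p \<kappa>) (r \<kappa>) (s \<kappa>) (t \<kappa>) (v \<kappa>) n / PV_den_v (a \<kappa>) w (v \<kappa>) n)
        = of_real (q powr (2 * of_int n + 1 + \<alpha>)) * lhs_v (u \<kappa>) (v \<kappa>) n"
      using sol by (auto elim!: eventually_mono simp: alpha_q_PV_def)
    then show "of_real (q powr (2 * of_int n + 1 + \<alpha>)) * lhs_v U V n = PI_rhs_v c V n"
      using lim_v[OF u v, of n] V n
      by (auto intro: tendsto_unique[OF at_neq_bot] Lim_transform_eventually)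
  qed
  show ?thesis
    using admissible lim_u lim_v limit_solves by (intro conjI allI impI; (elim conjE)?) blast+
qed

end
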